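(* Let $f:\mathbb{R}^n\to\mathbb{R}$ be a Lipschitz subdifferentiable function whose subdifferential mapping $\partial f(\cdot)$ is upper semicontinuous, as a set-valued mapping, at $x\in\mathbb{R}^n$. Then $f$ is continuously codifferentiable at $x$.
   Context: $f$ is subdifferentiable at $y$ if there is a convex compact set $\partial f(y)\subset\mathbb{R}^n$ (the subdifferential) with $f(y+\Delta)=f(y)+\max_{v\in\partial f(y)}(v,\Delta)+o_y(\Delta)$, where $o_y(\Delta)\to 0$ as $\Delta\to0$ and $o_y(\alpha\Delta)/\alpha\to0$ as $\alpha\to+0$; $f$ is subdifferentiable if this holds at every point. $f$ is codifferentiable at $y$ if there are convex compact sets $\underline{d}f(y),\overline{d}f(y)\subset\mathbb{R}^{n+1}=\mathbb{R}\times\mathbb{R}^n$ (hypodifferential and hyperdifferential) with $$f(y+\Delta)=f(y)+\max_{[a,v]\in\underline{d}f(y)}[a+(v,\Delta)]+\min_{[b,w]\in\overline{d}f(y)}[b+(w,\Delta)]+o_y(\Delta),$$ with $o_y$ as before; the pair $[\underline{d}f(y),\overline{d}f(y)]$ is a (first) codifferential of $f$ at $y$. $f$ is continuously codifferentiable at $x$ if it is codifferentiable in a neighborhood of $x$ and the codifferentials can be chosen so that $y\mapsto[\underline{d}f(y),\overline{d}f(y)]$ is continuous at $x$ in the Hausdorff metric. *)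

theory Defs
  imports "HOL-Analysis.Analysis"
begin

text \<open>
  The maxima and minima below are written as suprema and infima; they are attained because the
  sets are required to be nonempty and compact. Nonemptiness is implicit in the existence of the
  maximum.
\<close>

definition max_over :: "'b set \<Rightarrow> ('b \<Rightarrow> real) \<Rightarrow> real" where
  "max_over S g = (SUP v\<in>S. g v)"

definition min_over :: "'b set \<Rightarrow> ('b \<Rightarrow> real) \<Rightarrow> real" where
  "min_over S g = (INF v\<in>S. g v)"

text \<open>
  The second condition is for each fixed direction, not uniform in the direction. The direction
  \<open>0\<close> is included and forces \<open>r 0 = 0\<close>.
\<close>

definition small_remainder :: "('a::real_normed_vector \<Rightarrow> real) \<Rightarrow> bool" where
  "small_remainder r \<longleftrightarrow>
     (r \<longlongrightarrow> 0) (at 0) \<and>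
     (\<forall>\<Delta>. ((\<lambda>\<alpha>. r (\<alpha> *\<^sub>R \<Delta>) / \<alpha>) \<longlongrightarrow> 0) (at_right 0))"

definition has_subdifferential ::
  "('a::euclidean_space \<Rightarrow> real) \<Rightarrow> 'a set \<Rightarrow> 'a \<Rightarrow> bool" where
  "has_subdifferential f S y \<longleftrightarrow>
     S \<noteq> {} \<and> convex S \<and> compact S \<and>
     (\<exists>r. small_remainder r \<and>
        (\<forall>\<Delta>. f (y + \<Delta>) = f y + max_over S (\<lambda>v. v \<bullet> \<Delta>) + r \<Delta>))"

definition has_codifferential ::
  "('a::euclidean_space \<Rightarrow> real) \<Rightarrow> (real \<times> 'a) set \<Rightarrow> (real \<times> 'a) set \<Rightarrow> 'a \<Rightarrow> bool" where
  "has_codifferential f H K y \<longleftrightarrow>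
     H \<noteq> {} \<and> convex H \<and> compact H \<and>
     K \<noteq> {} \<and> convex K \<and> compact K \<and>
     (\<exists>r. small_remainder r \<and>
        (\<forall>\<Delta>. f (y + \<Delta>) = f y
              + max_over H (\<lambda>(a, v). a + v \<bullet> \<Delta>)
              + min_over K (\<lambda>(b, w). b + w \<bullet> \<Delta>) + r \<Delta>))"

text \<open>The formula is meaningful for nonempty bounded sets; it is only used for nonempty compact ones.\<close>

definition hausdorff_distance :: "'b::metric_space set \<Rightarrow> 'b set \<Rightarrow> real" where
  "hausdorff_distance A B = max (SUP a\<in>A. infdist a B) (SUP b\<in>B. infdist b A)"

definition hausdorff_continuous_at ::
  "('a::topological_space \<Rightarrow> 'b::metric_space set) \<Rightarrow> 'a \<Rightarrow> bool" where
  "hausdorff_continuous_at F x \<longleftrightarrow> ((\<lambda>y. hausdorff_distance (F y) (F x)) \<longlongrightarrow> 0) (at x)"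

definition upper_semicontinuous_at ::
  "('a::topological_space \<Rightarrow> 'b::topological_space set) \<Rightarrow> 'a \<Rightarrow> bool" where
  "upper_semicontinuous_at F x \<longleftrightarrow>
     (\<forall>V. open V \<longrightarrow> F x \<subseteq> V \<longrightarrow> (\<forall>\<^sub>F y in nhds x. F y \<subseteq> V))"

definition continuously_codifferentiable_at ::
  "('a::euclidean_space \<Rightarrow> real) \<Rightarrow> 'a \<Rightarrow> bool" where
  "continuously_codifferentiable_at f x \<longleftrightarrow>
     (\<exists>H K U. open U \<and> x \<in> U \<and>
        (\<forall>y\<in>U. has_codifferential f (H y) (K y) y) \<and>
        hausdorff_continuous_at H x \<and> hausdorff_continuous_at K x)"

end

theory Submission
  imports Defs
begin

text \<open>
  Take the hyperdifferential \<open>{0}\<close> and as hypodifferential at \<open>y\<close> the convex hull of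
  \<open>{0} \<times> \<partial>f(y)\<close> and \<open>{- |y - x|} \<times> \<partial>f(x)\<close>. The second piece is inactive for small increments
  unless \<open>y = x\<close>, when it coincides with the first, so this is a codifferential at \<open>y\<close>. It makes
  the hypodifferential at \<open>x\<close> lie within \<open>|y - x|\<close> of the one at \<open>y\<close>; the opposite
  inclusion up to a small error is the upper semicontinuity of \<open>\<partial>f\<close>.
\<close>

text \<open>Both conditions depend only on the germ at 0, since
  \<open>\<alpha> *\<^sub>R \<Delta>\<close> tends to 0 along every ray. The filter is
  \<open>nhds 0\<close>, not \<open>at 0\<close>, because the direction 0 tests the value at 0
  itself.\<close>

lemma small_remainder_cong:
  fixes r s :: "'a::real_normed_vector \<Rightarrow> real"
  assumes "small_remainder r" and eq: "\<forall>\<^sub>F \<Delta> in nhds 0. s \<Delta> = r \<Delta>"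
  shows "small_remainder s"
  unfolding small_remainder_def
proof (intro conjI allI)
  have "\<forall>\<^sub>F \<Delta> in at 0. s \<Delta> = r \<Delta>"
    using eq by (simp add: eventually_nhds_conv_at)
  then show "(s \<longlongrightarrow> 0) (at 0)"
    using assms(1) unfolding small_remainder_def by (simp cong: tendsto_cong)
  fix \<Delta> :: 'a
  have "((\<lambda>\<alpha>. \<alpha> *\<^sub>R \<Delta>) \<longlongrightarrow> 0 *\<^sub>R \<Delta>) (at_right (0::real))"
    by (intro tendsto_intros)
  then have "\<forall>\<^sub>F \<alpha> in at_right (0::real). s (\<alpha> *\<^sub>R \<Delta>) = r (\<alpha> *\<^sub>R \<Delta>)"
    using eventually_compose_filterlim[OF eq] by simp
  then have "\<forall>\<^sub>F \<alpha> in at_right (0::real). s (\<alpha> *\<^sub>R \<Delta>) / \<alpha> = r (\<alpha> *\<^sub>R \<Delta>) / \<alpha>"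
    by eventually_elim simp
  then show "((\<lambda>\<alpha>. s (\<alpha> *\<^sub>R \<Delta>) / \<alpha>) \<longlongrightarrow> 0) (at_right 0)"
    using assms(1) unfolding small_remainder_def by (simp only: tendsto_cong)
qed

lemma abs_hausdorff_distance_le:
  assumes "A \<noteq> {}" "B \<noteq> {}"
    and A: "\<And>a. a \<in> A \<Longrightarrow> infdist a B \<le> e" and B: "\<And>b. b \<in> B \<Longrightarrow> infdist b A \<le> e"
  shows "\<bar>hausdorff_distance A B\<bar> \<le> e"
proof -
  obtain a where a: "a \<in> A" using assms by blast
  have "bdd_above ((\<lambda>a. infdist a B) ` A)" using A by (rule bdd_aboveI2)
  \<comment> \<open>One nonnegative supremum makes the maximum nonnegative, so the upper bound also
    bounds the absolute value.\<close>
  then have "0 \<le> (SUP a\<in>A. infdist a B)"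
    by (rule cSUP_upper2[OF _ a]) (rule infdist_nonneg)
  moreover have "(SUP a\<in>A. infdist a B) \<le> e" "(SUP b\<in>B. infdist b A) \<le> e"
    using assms by (auto intro!: cSUP_least)
  ultimately show ?thesis unfolding hausdorff_distance_def by linarith
qed

text \<open>In the main proof \<open>d\<close> is the distance from \<open>y\<close> to
  \<open>x\<close>, and \<open>S\<close>, \<open>T\<close> are the subdifferentials at
  \<open>y\<close> and at \<open>x\<close>.\<close>

definition hypo_hull :: "real \<Rightarrow> 'a::euclidean_space set \<Rightarrow> 'a set \<Rightarrow> (real \<times> 'a) set" where
  "hypo_hull d S T = convex hull (({0} \<times> S) \<union> ({- d} \<times> T))"

lemma inner_le_max_over:
  assumes "bounded S" "v \<in> S"
  shows "v \<bullet> \<Delta> \<le> max_over S (\<lambda>v. v \<bullet> \<Delta>)"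
proof -
  have "bdd_above ((\<lambda>v. v \<bullet> \<Delta>) ` S)"
    using assms(1)
    by (intro bounded_imp_bdd_above bounded_linear_image bounded_linear_inner_left)
  then show ?thesis
    unfolding max_over_def using assms(2) by (rule cSUP_upper2) simp
qed

text \<open>The points where the functional is at most the maximum over \<open>S\<close> form a
  half-space. It contains both generating pieces, the lowered one by the hypothesis on
  \<open>T\<close>, and hence their hull. Conversely, the hull contains
  \<open>{0} \<times> S\<close>.\<close>

lemma max_over_hypo_hull_eq:
  assumes "S \<noteq> {}" "bounded S"
    and T: "\<And>v. v \<in> T \<Longrightarrow> v \<bullet> \<Delta> - d \<le> max_over S (\<lambda>v. v \<bullet> \<Delta>)"
  shows "max_over (hypo_hull d S T) (\<lambda>(a, v). a + v \<bullet> \<Delta>) = max_over S (\<lambda>v. v \<bullet> \<Delta>)"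
proof -
  let ?m = "max_over S (\<lambda>v. v \<bullet> \<Delta>)"
  let ?g = "\<lambda>(a, v). a + v \<bullet> \<Delta>"
  note S = inner_le_max_over[OF assms(2), of _ \<Delta>]
  have half: "{p. ?g p \<le> ?m} = {p. (1, \<Delta>) \<bullet> p \<le> ?m}"
    by (auto simp: inner_commute)
  have "hypo_hull d S T \<subseteq> {p. ?g p \<le> ?m}"
    unfolding hypo_hull_def
  proof (rule hull_minimal)
    show "{0} \<times> S \<union> {- d} \<times> T \<subseteq> {p. ?g p \<le> ?m}" using S T by fastforce
    show "convex {p. ?g p \<le> ?m}" unfolding half by (rule convex_halfspace_le)
  qed
  then have upper: "?g p \<le> ?m" if "p \<in> hypo_hull d S T" for p using that by blast
  have sub: "(0, v) \<in> hypo_hull d S T" if "v \<in> S" for v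
    unfolding hypo_hull_def using that by (intro hull_inc) simp
  show ?thesis
  proof (rule antisym)
    show "max_over (hypo_hull d S T) ?g \<le> ?m"
      unfolding max_over_def[of "hypo_hull d S T"]
      using upper sub assms(1) by (intro cSUP_least) blast+
    have "bdd_above (?g ` hypo_hull d S T)"
      using upper by (intro bdd_aboveI2) auto
    then have "v \<bullet> \<Delta> \<le> max_over (hypo_hull d S T) ?g" if "v \<in> S" for v
      unfolding max_over_def by (rule cSUP_upper2[OF _ sub[OF that]]) simp
    then show "?m \<le> max_over (hypo_hull d S T) ?g"
      unfolding max_over_def[of S] using assms(1) by (intro cSUP_least)
  qed
qed

text \<open>With \<open>B\<close> bounding the norms on \<open>T\<close> and \<open>s\<close> any
  point of \<open>S\<close>, the lowered piece gives at most \<open>B * norm \<Delta> - d\<close>,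
  while the maximum over \<open>S\<close> is at least \<open>- norm s * norm \<Delta>\<close>. The
  gap \<open>d\<close> decides as soon as \<open>(B + norm s) * norm \<Delta> < d\<close>.\<close>

lemma eventually_max_over_hypo_hull_eq:
  fixes S T :: "'a::euclidean_space set"
  assumes "S \<noteq> {}" "bounded S" "bounded T" "d > 0"
  shows "\<forall>\<^sub>F \<Delta> in nhds 0. max_over (hypo_hull d S T) (\<lambda>(a, v). a + v \<bullet> \<Delta>) = max_over S (\<lambda>v. v \<bullet> \<Delta>)"
proof -
  obtain s where s: "s \<in> S" using assms(1) by blast
  obtain B where B: "\<And>v. v \<in> T \<Longrightarrow> norm v \<le> B"
    using assms(3) unfolding bounded_iff by blast
  have "((\<lambda>\<Delta>::'a. (B + norm s) * norm \<Delta>) \<longlongrightarrow> (B + norm s) * norm (0::'a)) (nhds 0)"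
    by (intro tendsto_intros) (simp add: filterlim_ident)
  then have "\<forall>\<^sub>F \<Delta>::'a in nhds 0. (B + norm s) * norm \<Delta> < d"
    using assms(4) by (simp add: order_tendstoD(2))
  then show ?thesis
  proof eventually_elim
    case (elim \<Delta>)
    have *: "s \<bullet> \<Delta> \<le> max_over S (\<lambda>v. v \<bullet> \<Delta>)"
      using assms(2) s by (rule inner_le_max_over)
    show ?case
    proof (rule max_over_hypo_hull_eq[OF assms(1,2)])
      fix v assume "v \<in> T"
      then have "v \<bullet> \<Delta> \<le> B * norm \<Delta>"
        using norm_cauchy_schwarz[of v \<Delta>] mult_right_mono[OF B[of v] norm_ge_zero[of \<Delta>]]
        by linarith
      moreover have "- (norm s * norm \<Delta>) \<le> s \<bullet> \<Delta>"
        using Cauchy_Schwarz_ineq2[of s \<Delta>] by linarith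
      ultimately show "v \<bullet> \<Delta> - d \<le> max_over S (\<lambda>v. v \<bullet> \<Delta>)"
        using elim * by (simp add: algebra_simps)
    qed
  qed
qed

lemma has_codifferential_hypo_hull:
  fixes f :: "'a::euclidean_space \<Rightarrow> real"
  assumes f: "has_subdifferential f S y" and T: "compact T"
    and d: "d > 0 \<or> d = 0 \<and> T = S"
  shows "has_codifferential f (hypo_hull d S T) {0} y"
proof -
  obtain r where S: "S \<noteq> {}" "compact S" and r: "small_remainder r"
    and eq: "\<And>\<Delta>. f (y + \<Delta>) = f y + max_over S (\<lambda>v. v \<bullet> \<Delta>) + r \<Delta>"
    using f unfolding has_subdifferential_def by blast
  let ?M = "\<lambda>\<Delta>. max_over (hypo_hull d S T) (\<lambda>(a, v). a + v \<bullet> \<Delta>)"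
  have "\<forall>\<^sub>F \<Delta> in nhds 0. ?M \<Delta> = max_over S (\<lambda>v. v \<bullet> \<Delta>)"
  proof (cases "d > 0")
    case True
    then show ?thesis
      using S T by (intro eventually_max_over_hypo_hull_eq compact_imp_bounded)
  next
    \<comment> \<open>With no gap, smallness of the increment cannot help; here \<open>T = S\<close>
      makes the two maxima equal for every increment.\<close>
    case False
    then have "d = 0" "T = S" using d by auto
    then have "?M \<Delta> = max_over S (\<lambda>v. v \<bullet> \<Delta>)" for \<Delta>
      using S compact_imp_bounded[OF S(2)]
      by (intro max_over_hypo_hull_eq) (auto intro: inner_le_max_over)
    then show ?thesis by simp
  qed
  \<comment> \<open>The expansion must hold for all increments, but the maxima are known to agree
    only near 0. The new remainder is therefore the whole discrepancy, which equals \<open>r\<close>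
    near 0.\<close>
  then have "\<forall>\<^sub>F \<Delta> in nhds 0. f (y + \<Delta>) - f y - ?M \<Delta> = r \<Delta>"
    by eventually_elim (simp add: eq)
  then have "small_remainder (\<lambda>\<Delta>. f (y + \<Delta>) - f y - ?M \<Delta>)"
    by (rule small_remainder_cong[OF r])
  moreover have "hypo_hull d S T \<noteq> {}" "convex (hypo_hull d S T)" "compact (hypo_hull d S T)"
    unfolding hypo_hull_def using S T
    by (auto simp: convex_convex_hull intro!: compact_convex_hull compact_Un compact_Times)
  ultimately show ?thesis
    unfolding has_codifferential_def
    by (intro conjI exI[of _ "\<lambda>\<Delta>. f (y + \<Delta>) - f y - ?M \<Delta>"])
      (auto simp: min_over_def zero_prod_def)
qed

text \<open>The closed \<open>e\<close>-neighbourhood of a convex set is convex, so for the hull it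
  suffices to check the generators: \<open>S\<close> is within \<open>e\<close> of \<open>T\<close>,
  and the other piece is shifted by \<open>d\<close>. Conversely, \<open>(0, v)\<close> is at
  distance \<open>d\<close> from the hull point \<open>(- d, v)\<close>.\<close>

lemma hausdorff_distance_hypo_hull_le:
  fixes S T :: "'a::euclidean_space set"
  assumes "T \<noteq> {}" "convex T" "0 \<le> d" "d \<le> e"
    and S: "S \<subseteq> (\<Union>v\<in>T. ball v e)"
  shows "\<bar>hausdorff_distance (hypo_hull d S T) ({0} \<times> T)\<bar> \<le> e"
proof (rule abs_hausdorff_distance_le)
  show "{0} \<times> T \<noteq> {}" using assms(1) by simp
  show "hypo_hull d S T \<noteq> {}" unfolding hypo_hull_def using assms(1) by simp
  \<comment> \<open>The neighbourhood is written as a Minkowski sum, whose convexity follows from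
    that of its two summands.\<close>
  let ?N = "\<Union>p\<in>{0::real} \<times> T. \<Union>q\<in>cball 0 e. {p + q}"
  have "hypo_hull d S T \<subseteq> ?N"
    unfolding hypo_hull_def
  proof (rule hull_minimal)
    show "convex ?N"
      using assms(2) by (intro convex_sums convex_Times) auto
    have "(0, v) \<in> ?N" if "v \<in> S" for v
    proof -
      obtain w where w: "w \<in> T" "dist w v < e" using subsetD[OF S \<open>v \<in> S\<close>] by auto
      then have "(0::real, v) = (0, w) + (0, v - w)" "(0, v - w) \<in> cball (0::real \<times> 'a) e"
        by (auto simp: zero_prod_def dist_Pair_Pair dist_norm norm_minus_commute)
      then show ?thesis using w(1) by (intro UN_I[of "(0, w)"] UN_I[of "(0, v - w)"]) simp_all
    qed
    moreover have "(- d, v) \<in> ?N" if "v \<in> T" for v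
    proof -
      have "(- d, v) = (0, v) + (- d, 0)" "(- d, 0) \<in> cball (0::real \<times> 'a) e"
        using assms(3,4) by (auto simp: zero_prod_def dist_Pair_Pair)
      then show ?thesis using that by (intro UN_I[of "(0, v)"] UN_I[of "(- d, 0)"]) simp_all
    qed
    ultimately show "{0} \<times> S \<union> {- d} \<times> T \<subseteq> ?N" by blast
  qed
  then show "infdist p ({0} \<times> T) \<le> e" if "p \<in> hypo_hull d S T" for p
  proof -
    have "p \<in> ?N" using that \<open>hypo_hull d S T \<subseteq> ?N\<close> by blast
    then obtain b q where "b \<in> {0} \<times> T" "q \<in> cball 0 e" "p = b + q" by blast
    then show ?thesis by (intro infdist_le2[of b]) (auto simp: dist_norm)
  qed
  show "infdist b (hypo_hull d S T) \<le> e" if "b \<in> {0} \<times> T" for b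
  proof -
    obtain v where v: "b = (0, v)" "v \<in> T" using \<open>b \<in> {0} \<times> T\<close> by blast
    have "(- d, v) \<in> hypo_hull d S T"
      unfolding hypo_hull_def using v by (intro hull_inc) simp
    then show ?thesis
      using v assms(3,4) by (intro infdist_le2[of "(- d, v)"]) (auto simp: dist_Pair_Pair)
  qed
qed

theorem theorem6p1:
  fixes f :: "real ^ 'n \<Rightarrow> real"
    and subdiff :: "real ^ 'n \<Rightarrow> (real ^ 'n) set"
    and x :: "real ^ 'n"
  assumes "\<exists>L. L-lipschitz_on UNIV f"
    and "\<And>y. has_subdifferential f (subdiff y) y"
    and "upper_semicontinuous_at subdiff x"
  shows "continuously_codifferentiable_at f x"
proof -
  let ?T = "subdiff x"
  define H where "H = (\<lambda>y. hypo_hull (dist y x) (subdiff y) ?T)"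
  have T: "?T \<noteq> {}" "convex ?T" "compact ?T"
    using assms(2)[of x] unfolding has_subdifferential_def by auto
  have cod: "has_codifferential f (H y) {0} y" for y
    unfolding H_def using assms(2) T(3) by (rule has_codifferential_hypo_hull) auto
  \<comment> \<open>At distance 0 both pieces are this product, which is already convex.\<close>
  have Hx: "H x = {0} \<times> ?T"
    unfolding H_def hypo_hull_def using T(2) by (simp add: convex_Times convex_hull_eq)
  have "hausdorff_continuous_at H x"
    unfolding hausdorff_continuous_at_def
  proof (rule tendstoI)
    fix e :: real assume "e > 0"
    \<comment> \<open>The radius \<open>e/2\<close> turns the non-strict Hausdorff bound into the
      strict one that the limit requires.\<close>
    have "open (\<Union>v\<in>?T. ball v (e/2))" "?T \<subseteq> (\<Union>v\<in>?T. ball v (e/2))"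
      using \<open>e > 0\<close> by auto
    then have "\<forall>\<^sub>F y in nhds x. subdiff y \<subseteq> (\<Union>v\<in>?T. ball v (e/2))"
      using assms(3) unfolding upper_semicontinuous_at_def by blast
    then have 1: "\<forall>\<^sub>F y in at x. subdiff y \<subseteq> (\<Union>v\<in>?T. ball v (e/2))"
      by (simp add: eventually_nhds_conv_at)
    have 2: "\<forall>\<^sub>F y in at x. dist y x < e/2"
      using tendstoD[OF tendsto_ident_at, of "e/2"] \<open>e > 0\<close> by simp
    show "\<forall>\<^sub>F y in at x. dist (hausdorff_distance (H y) (H x)) 0 < e"
      using 1 2
    proof eventually_elim
      case (elim y)
      have "\<bar>hausdorff_distance (H y) (H x)\<bar> \<le> e/2"
        unfolding Hx unfolding H_def
        using T elim by (intro hausdorff_distance_hypo_hull_le) auto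
      then show ?case using \<open>e > 0\<close> by simp
    qed
  qed
  moreover have "hausdorff_continuous_at (\<lambda>_. {0 :: real \<times> (real ^ 'n)}) x"
    unfolding hausdorff_continuous_at_def hausdorff_distance_def by simp
  ultimately show ?thesis
    unfolding continuously_codifferentiable_at_def
    using cod open_UNIV UNIV_I by fast
qed

end
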